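(* Let $F\dashv G:\mathcal{C}\to\mathcal{A}$ be adjoint functors (so $F:\mathcal{A}\to\mathcal{C}$ is left adjoint to $G$) with unit $\eta:1_{\mathcal{A}}\to GF$, and let $\mathcal{B}$ be a base for a quasi-uniformity $\mathcal{U}$ on $\mathcal{C}$ with respect to $\mathcal{M}$. Assume that $G$ and $F$ preserve subobjects. For $X\in\mathcal{A}$ put $$\mathcal{B}^{\eta}_X=\{U^{\eta}\;|\;U\in\mathcal{B}_{FX}\},\qquad U^{\eta}(m)=\eta_X^{-1}\big(G(U(Fm))\big)\quad(m\in\mathrm{sub}X).$$ Then $\mathcal{B}^{\eta}$ is a base for a quasi-uniformity $\mathcal{U}^{\eta}$ on $\mathcal{A}$, and $\mathcal{U}^{\eta}$ is the coarsest quasi-uniformity on $\mathcal{A}$ for which $F$ is $(\mathcal{U}^{\eta},\mathcal{U})$-continuous.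
   Context: $\mathcal{C}$ is a category with a proper $(\mathcal{E},\mathcal{M})$-factorization system for morphisms ($\mathcal{E}$ consists of epimorphisms, $\mathcal{M}$ of monomorphisms), and it is $\mathcal{M}$-complete: pullbacks of $\mathcal{M}$-morphisms along arbitrary morphisms and arbitrary $\mathcal{M}$-intersections exist and are again in $\mathcal{M}$. Likewise $\mathcal{A}$ is a category with an $(\mathcal{E}',\mathcal{M}')$-factorization system and is $\mathcal{M}'$-complete. For $X\in\mathcal{C}$, $\mathrm{sub}X=\{m\in\mathcal{M}\mid \mathrm{cod}(m)=X\}$, ordered by $n\le m$ iff $m\circ j=n$ for some $j$; isomorphic subobjects are identified, so $\mathrm{sub}X$ is a (possibly large) complete lattice. For $f:X\to Y$, $f(m)$ is the $\mathcal{M}$-component of the factorization of $f\circ m$ and $f^{-1}(n)$ is the pullback of $n$ along $f$. The same conventions apply to $\mathcal{A}$ with $\mathcal{M}'$. $F$ preserves subobjects if $Fm\in\mathcal{M}$ for every $m\in\mathcal{M}'$; $G$ preserves subobjects if $Gn\in\mathcal{M}'$ for every $n\in\mathcal{M}$. A quasi-uniformity on $\mathcal{C}$ with respect to $\mathcal{M}$ (likewise on $\mathcal{A}$ with respect to $\mathcal{M}'$) is a family $\mathcal{U}=\{\mathcal{U}_X\}$ indexed by objects, each $\mathcal{U}_X$ a collection of order-preserving maps $\mathrm{sub}X\to\mathrm{sub}X$ (ordered pointwise), such that (U1) $m\le U(m)$ for all $m$ and $U\in\mathcal{U}_X$; (U2) for $U\in\mathcal{U}_X$ there is $U'\in\mathcal{U}_X$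 with $U'\circ U'\le U$; (U3) $U\in\mathcal{U}_X$, $U\le U'$ imply $U'\in\mathcal{U}_X$; (U4) $U,U'\in\mathcal{U}_X$ imply $U\wedge U'\in\mathcal{U}_X$; (U5) for $f:X\to Y$ and $U\in\mathcal{U}_Y$ there is $U'\in\mathcal{U}_X$ with $f(U'(m))\le U(f(m))$ for all $m\in\mathrm{sub}X$. A base is a family $\mathcal{B}=\{\mathcal{B}_X\}$ satisfying all of these except (U3); the quasi-uniformity it generates consists of all $V$ lying above some member of the base. Order: $\mathcal{U}\le\mathcal{V}$ iff for all $X$ and $U\in\mathcal{U}_X$ there is $V\in\mathcal{V}_X$ with $V\le U$; "coarsest" means least. For quasi-uniformities $\mathcal{W}$ on $\mathcal{A}$ and $\mathcal{U}$ on $\mathcal{C}$, $F$ is $(\mathcal{W},\mathcal{U})$-continuous if for all $X\in\mathcal{A}$ and $U\in\mathcal{U}_{FX}$ there is $W\in\mathcal{W}_X$ such that $F(W(m))\le U(Fm)$ for all $m\in\mathrm{sub}X$. *)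

theory Defs
  imports "HOL-Algebra.Lattice"
begin

section \<open>Categories, functors, adjunctions\<close>

text \<open>Objects and arrows live in arbitrary carrier sets of arbitrary types; no smallness condition
  is imposed, so a ``large'' collection of arrows is simply a set of arrows.  Composition is a total
  function that is meaningful only on composable pairs.\<close>

record ('o, 'a) cat_data =
  Obj :: "'o set"
  Arr :: "'a set"
  Dom :: "'a \<Rightarrow> 'o"
  Cod :: "'a \<Rightarrow> 'o"
  Ident :: "'o \<Rightarrow> 'a"
  Comp :: "'a \<Rightarrow> 'a \<Rightarrow> 'a"  (infixl "\<odot>\<index>" 70)

definition Hom :: "('o, 'a) cat_data \<Rightarrow> 'o \<Rightarrow> 'o \<Rightarrow> 'a set" where
  "Hom C X Y = {f \<in> Arr C. Dom C f = X \<and> Cod C f = Y}"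

locale category =
  fixes C :: "('o, 'a) cat_data" (structure)
  assumes dom_obj: "f \<in> Arr C \<Longrightarrow> Dom C f \<in> Obj C"
    and cod_obj: "f \<in> Arr C \<Longrightarrow> Cod C f \<in> Obj C"
    and ident_hom: "X \<in> Obj C \<Longrightarrow> Ident C X \<in> Hom C X X"
    and comp_hom: "\<lbrakk>f \<in> Hom C X Y; g \<in> Hom C Y Z\<rbrakk> \<Longrightarrow> g \<odot> f \<in> Hom C X Z"
    and ident_left: "f \<in> Hom C X Y \<Longrightarrow> Ident C Y \<odot> f = f"
    and ident_right: "f \<in> Hom C X Y \<Longrightarrow> f \<odot> Ident C X = f"
    and comp_assoc: "\<lbrakk>f \<in> Hom C X Y; g \<in> Hom C Y Z; h \<in> Hom C Z W\<rbrakk>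
                     \<Longrightarrow> (h \<odot> g) \<odot> f = h \<odot> (g \<odot> f)"

definition is_iso :: "('o, 'a) cat_data \<Rightarrow> 'a \<Rightarrow> bool" where
  "is_iso C h \<longleftrightarrow> h \<in> Arr C \<and>
     (\<exists>k \<in> Hom C (Cod C h) (Dom C h).
        k \<odot>\<^bsub>C\<^esub> h = Ident C (Dom C h) \<and> h \<odot>\<^bsub>C\<^esub> k = Ident C (Cod C h))"

definition is_mono :: "('o, 'a) cat_data \<Rightarrow> 'a \<Rightarrow> bool" where
  "is_mono C m \<longleftrightarrow> m \<in> Arr C \<and>
     (\<forall>X. \<forall>u \<in> Hom C X (Dom C m). \<forall>v \<in> Hom C X (Dom C m). m \<odot>\<^bsub>C\<^esub> u = m \<odot>\<^bsub>C\<^esub> v \<longrightarrow> u = v)"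

definition is_epi :: "('o, 'a) cat_data \<Rightarrow> 'a \<Rightarrow> bool" where
  "is_epi C e \<longleftrightarrow> e \<in> Arr C \<and>
     (\<forall>Y. \<forall>u \<in> Hom C (Cod C e) Y. \<forall>v \<in> Hom C (Cod C e) Y. u \<odot>\<^bsub>C\<^esub> e = v \<odot>\<^bsub>C\<^esub> e \<longrightarrow> u = v)"

text \<open>The square with sides \<open>p\<close>, \<open>f\<close> and \<open>q\<close>, \<open>n\<close> is a pullback; \<open>p\<close> is the pullback of \<open>n\<close> along \<open>f\<close>.\<close>

definition is_pullback :: "('o, 'a) cat_data \<Rightarrow> 'a \<Rightarrow> 'a \<Rightarrow> 'a \<Rightarrow> 'a \<Rightarrow> bool" where
  "is_pullback C f n p q \<longleftrightarrow>
     f \<in> Arr C \<and> n \<in> Arr C \<and> Cod C f = Cod C n \<and>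
     p \<in> Hom C (Dom C p) (Dom C f) \<and> q \<in> Hom C (Dom C p) (Dom C n) \<and>
     f \<odot>\<^bsub>C\<^esub> p = n \<odot>\<^bsub>C\<^esub> q \<and>
     (\<forall>Z. \<forall>u \<in> Hom C Z (Dom C f). \<forall>v \<in> Hom C Z (Dom C n). f \<odot>\<^bsub>C\<^esub> u = n \<odot>\<^bsub>C\<^esub> v \<longrightarrow>
        (\<exists>!w. w \<in> Hom C Z (Dom C p) \<and> p \<odot>\<^bsub>C\<^esub> w = u \<and> q \<odot>\<^bsub>C\<^esub> w = v))"

definition is_functor ::
  "('p, 'b) cat_data \<Rightarrow> ('o, 'a) cat_data \<Rightarrow> ('p \<Rightarrow> 'o) \<Rightarrow> ('b \<Rightarrow> 'a) \<Rightarrow> bool" where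
  "is_functor A C Fo Fa \<longleftrightarrow>
     (\<forall>X \<in> Obj A. Fo X \<in> Obj C) \<and>
     (\<forall>X Y. \<forall>f \<in> Hom A X Y. Fa f \<in> Hom C (Fo X) (Fo Y)) \<and>
     (\<forall>X \<in> Obj A. Fa (Ident A X) = Ident C (Fo X)) \<and>
     (\<forall>X Y Z. \<forall>f \<in> Hom A X Y. \<forall>g \<in> Hom A Y Z. Fa (g \<odot>\<^bsub>A\<^esub> f) = Fa g \<odot>\<^bsub>C\<^esub> Fa f)"

text \<open>\<open>F : A \<rightarrow> C\<close> is left adjoint to \<open>G : C \<rightarrow> A\<close> with unit \<open>\<eta>\<close>: a natural transformation
  \<open>1 \<rightarrow> GF\<close> all of whose components are universal arrows to \<open>G\<close>.\<close>

definition is_adjunction ::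
  "('p, 'b) cat_data \<Rightarrow> ('o, 'a) cat_data \<Rightarrow> ('p \<Rightarrow> 'o) \<Rightarrow> ('b \<Rightarrow> 'a) \<Rightarrow>
   ('o \<Rightarrow> 'p) \<Rightarrow> ('a \<Rightarrow> 'b) \<Rightarrow> ('p \<Rightarrow> 'b) \<Rightarrow> bool" where
  "is_adjunction A C Fo Fa Go Ga \<eta> \<longleftrightarrow>
     is_functor A C Fo Fa \<and> is_functor C A Go Ga \<and>
     (\<forall>X \<in> Obj A. \<eta> X \<in> Hom A X (Go (Fo X))) \<and>
     (\<forall>X Y. \<forall>f \<in> Hom A X Y. Ga (Fa f) \<odot>\<^bsub>A\<^esub> \<eta> X = \<eta> Y \<odot>\<^bsub>A\<^esub> f) \<and>
     (\<forall>X \<in> Obj A. \<forall>Y \<in> Obj C. \<forall>f \<in> Hom A X (Go Y).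
        \<exists>!g. g \<in> Hom C (Fo X) Y \<and> Ga g \<odot>\<^bsub>A\<^esub> \<eta> X = f)"


section \<open>Factorization systems and completeness\<close>

locale factorization_system = category C
  for C :: "('o, 'a) cat_data" (structure) and E M :: "'a set" +
  assumes E_arr: "E \<subseteq> Arr C"
    and M_arr: "M \<subseteq> Arr C"
    and E_iso_comp: "\<lbrakk>e \<in> E; is_iso C h; Dom C h = Cod C e\<rbrakk> \<Longrightarrow> h \<odot> e \<in> E"
    and E_comp_iso: "\<lbrakk>e \<in> E; is_iso C h; Cod C h = Dom C e\<rbrakk> \<Longrightarrow> e \<odot> h \<in> E"
    and M_iso_comp: "\<lbrakk>m \<in> M; is_iso C h; Dom C h = Cod C m\<rbrakk> \<Longrightarrow> h \<odot> m \<in> M"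
    and M_comp_iso: "\<lbrakk>m \<in> M; is_iso C h; Cod C h = Dom C m\<rbrakk> \<Longrightarrow> m \<odot> h \<in> M"
    and factorization: "f \<in> Arr C \<Longrightarrow> \<exists>e \<in> E. \<exists>m \<in> M. Cod C e = Dom C m \<and> f = m \<odot> e"
    and diagonal: "\<lbrakk>e \<in> E; m \<in> M; u \<in> Hom C (Dom C e) (Dom C m);
                    v \<in> Hom C (Cod C e) (Cod C m); v \<odot> e = m \<odot> u\<rbrakk>
                   \<Longrightarrow> \<exists>!d. d \<in> Hom C (Cod C e) (Dom C m) \<and> d \<odot> e = u \<and> m \<odot> d = v"

locale proper_factorization_system = factorization_system +
  assumes E_epi: "e \<in> E \<Longrightarrow> is_epi C e"
    and M_mono: "m \<in> M \<Longrightarrow> is_mono C m"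

text \<open>\<open>n \<le> m\<close> for arrows with the same codomain.\<close>

definition arr_le :: "('o, 'a) cat_data \<Rightarrow> 'a \<Rightarrow> 'a \<Rightarrow> bool" where
  "arr_le C n m \<longleftrightarrow> (\<exists>j \<in> Hom C (Dom C n) (Dom C m). m \<odot>\<^bsub>C\<^esub> j = n)"

text \<open>An intersection of a family of subobjects depends only on the set \<open>S\<close> of its members, and \<open>S\<close>
  may be any set of arrows in \<open>M\<close> with codomain \<open>X\<close>, including the empty one.\<close>

locale M_complete = category C
  for C :: "('o, 'a) cat_data" (structure) and M :: "'a set" +
  assumes pullbacks: "\<lbrakk>n \<in> M; f \<in> Arr C; Cod C f = Cod C n\<rbrakk>
                      \<Longrightarrow> \<exists>p \<in> M. \<exists>q. is_pullback C f n p q"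
    and intersections: "\<lbrakk>X \<in> Obj C; S \<subseteq> M; \<And>m. m \<in> S \<Longrightarrow> Cod C m = X\<rbrakk>
                        \<Longrightarrow> \<exists>i \<in> M. Cod C i = X \<and> (\<forall>m \<in> S. arr_le C i m) \<and>
                              (\<forall>f \<in> Arr C. Cod C f = X \<longrightarrow> (\<forall>m \<in> S. arr_le C f m) \<longrightarrow> arr_le C f i)"


section \<open>Subobjects\<close>

text \<open>A subobject is represented by its whole class of mutually factoring arrows in \<open>M\<close>.  For
  monomorphisms \<open>m\<close>, \<open>k\<close>, the relations \<open>k \<le> m\<close> and \<open>m \<le> k\<close> hold together iff \<open>k\<close> and \<open>m\<close> are
  isomorphic over their codomain.\<close>

definition sub_class :: "('o, 'a) cat_data \<Rightarrow> 'a set \<Rightarrow> 'a \<Rightarrow> 'a set" where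
  "sub_class C M m = {k \<in> M. Cod C k = Cod C m \<and> arr_le C k m \<and> arr_le C m k}"

definition Sub :: "('o, 'a) cat_data \<Rightarrow> 'a set \<Rightarrow> 'o \<Rightarrow> 'a set gorder" where
  "Sub C M X =
     \<lparr> carrier = sub_class C M ` {m \<in> M. Cod C m = X},
       eq = (=),
       le = (\<lambda>K L. \<exists>n \<in> K. \<exists>m \<in> L. arr_le C n m) \<rparr>"

text \<open>The operations on arrows below are determined up to isomorphism and do not depend on the
  representative, so each of the unions is a union of copies of one and the same class.\<close>

definition sub_image :: "('o, 'a) cat_data \<Rightarrow> 'a set \<Rightarrow> 'a set \<Rightarrow> 'a \<Rightarrow> 'a set \<Rightarrow> 'a set" where
  "sub_image C E M f K =
     \<Union> {sub_class C M k | k m e. m \<in> K \<and> e \<in> E \<and> k \<in> M \<and> Cod C e = Dom C k \<and>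
                                   f \<odot>\<^bsub>C\<^esub> m = k \<odot>\<^bsub>C\<^esub> e}"

definition sub_preimage :: "('o, 'a) cat_data \<Rightarrow> 'a set \<Rightarrow> 'a \<Rightarrow> 'a set \<Rightarrow> 'a set" where
  "sub_preimage C M f L = \<Union> {sub_class C M p | p n q. n \<in> L \<and> is_pullback C f n p q}"

definition preserves_subobjects :: "'b set \<Rightarrow> 'a set \<Rightarrow> ('b \<Rightarrow> 'a) \<Rightarrow> bool" where
  "preserves_subobjects N M Fa \<longleftrightarrow> (\<forall>m \<in> N. Fa m \<in> M)"

definition sub_map :: "('o, 'a) cat_data \<Rightarrow> 'a set \<Rightarrow> ('b \<Rightarrow> 'a) \<Rightarrow> 'b set \<Rightarrow> 'a set" where
  "sub_map C M Fa K = \<Union> {sub_class C M (Fa m) | m. m \<in> K}"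


section \<open>Quasi-uniformities\<close>

text \<open>Self-maps of \<open>Sub C M X\<close> are taken to be extensional, so that equality of functions in HOL is
  equality of maps.  Families are total functions on the type of objects, but only their values at
  the objects of the category matter.\<close>

definition monotone_maps :: "'s gorder \<Rightarrow> ('s \<Rightarrow> 's) set" where
  "monotone_maps L = {U \<in> carrier L \<rightarrow>\<^sub>E carrier L. isotone L L U}"

definition map_le :: "'s gorder \<Rightarrow> ('s \<Rightarrow> 's) \<Rightarrow> ('s \<Rightarrow> 's) \<Rightarrow> bool" where
  "map_le L U V \<longleftrightarrow> (\<forall>K \<in> carrier L. U K \<sqsubseteq>\<^bsub>L\<^esub> V K)"

definition map_meet :: "'s gorder \<Rightarrow> ('s \<Rightarrow> 's) \<Rightarrow> ('s \<Rightarrow> 's) \<Rightarrow> 's \<Rightarrow> 's" where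
  "map_meet L U V = (\<lambda>K \<in> carrier L. U K \<sqinter>\<^bsub>L\<^esub> V K)"

type_synonym ('o, 'a) map_family = "'o \<Rightarrow> ('a set \<Rightarrow> 'a set) set"

locale quasi_uniformity_base =
  fixes C :: "('o, 'a) cat_data" and E M :: "'a set" and \<U> :: "('o, 'a) map_family"
  assumes monotone: "X \<in> Obj C \<Longrightarrow> \<U> X \<subseteq> monotone_maps (Sub C M X)"
    and U1: "\<lbrakk>X \<in> Obj C; U \<in> \<U> X; K \<in> carrier (Sub C M X)\<rbrakk> \<Longrightarrow> K \<sqsubseteq>\<^bsub>Sub C M X\<^esub> U K"
    and U2: "\<lbrakk>X \<in> Obj C; U \<in> \<U> X\<rbrakk> \<Longrightarrow> \<exists>U' \<in> \<U> X. map_le (Sub C M X) (U' \<circ> U') U"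
    and U4: "\<lbrakk>X \<in> Obj C; U \<in> \<U> X; U' \<in> \<U> X\<rbrakk> \<Longrightarrow> map_meet (Sub C M X) U U' \<in> \<U> X"
    and U5: "\<lbrakk>f \<in> Hom C X Y; U \<in> \<U> Y\<rbrakk>
             \<Longrightarrow> \<exists>U' \<in> \<U> X. \<forall>K \<in> carrier (Sub C M X).
                   sub_image C E M f (U' K) \<sqsubseteq>\<^bsub>Sub C M Y\<^esub> U (sub_image C E M f K)"

locale quasi_uniformity = quasi_uniformity_base +
  assumes U3: "\<lbrakk>X \<in> Obj C; U \<in> \<U> X; U' \<in> monotone_maps (Sub C M X); map_le (Sub C M X) U U'\<rbrakk>
               \<Longrightarrow> U' \<in> \<U> X"

definition generated_qu ::
  "('o, 'a) cat_data \<Rightarrow> 'a set \<Rightarrow> ('o, 'a) map_family \<Rightarrow> ('o, 'a) map_family" where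
  "generated_qu C M \<B> X =
     {V \<in> monotone_maps (Sub C M X). \<exists>U \<in> \<B> X. map_le (Sub C M X) U V}"

definition qu_le ::
  "('o, 'a) cat_data \<Rightarrow> 'a set \<Rightarrow> ('o, 'a) map_family \<Rightarrow> ('o, 'a) map_family \<Rightarrow> bool" where
  "qu_le C M \<U> \<V> \<longleftrightarrow> (\<forall>X \<in> Obj C. \<forall>U \<in> \<U> X. \<exists>V \<in> \<V> X. map_le (Sub C M X) V U)"

definition qu_continuous ::
  "('p, 'b) cat_data \<Rightarrow> 'b set \<Rightarrow> ('o, 'a) cat_data \<Rightarrow> 'a set \<Rightarrow> ('p \<Rightarrow> 'o) \<Rightarrow> ('b \<Rightarrow> 'a) \<Rightarrow>
   ('p, 'b) map_family \<Rightarrow> ('o, 'a) map_family \<Rightarrow> bool" where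
  "qu_continuous A N C M Fo Fa \<W> \<U> \<longleftrightarrow>
     (\<forall>X \<in> Obj A. \<forall>U \<in> \<U> (Fo X). \<exists>W \<in> \<W> X. \<forall>K \<in> carrier (Sub A N X).
        sub_map C M Fa (W K) \<sqsubseteq>\<^bsub>Sub C M (Fo X)\<^esub> U (sub_map C M Fa K))"

definition unit_map ::
  "('p, 'b) cat_data \<Rightarrow> 'b set \<Rightarrow> ('o, 'a) cat_data \<Rightarrow> 'a set \<Rightarrow> ('b \<Rightarrow> 'a) \<Rightarrow> ('a \<Rightarrow> 'b) \<Rightarrow>
   ('p \<Rightarrow> 'b) \<Rightarrow> 'p \<Rightarrow> ('a set \<Rightarrow> 'a set) \<Rightarrow> 'b set \<Rightarrow> 'b set" where
  "unit_map A N C M Fa Ga \<eta> X U =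
     (\<lambda>K \<in> carrier (Sub A N X).
        sub_preimage A N (\<eta> X) (sub_map A N Ga (U (sub_map C M Fa K))))"

definition unit_base ::
  "('p, 'b) cat_data \<Rightarrow> 'b set \<Rightarrow> ('o, 'a) cat_data \<Rightarrow> 'a set \<Rightarrow> ('p \<Rightarrow> 'o) \<Rightarrow> ('b \<Rightarrow> 'a) \<Rightarrow>
   ('a \<Rightarrow> 'b) \<Rightarrow> ('p \<Rightarrow> 'b) \<Rightarrow> ('o, 'a) map_family \<Rightarrow> ('p, 'b) map_family" where
  "unit_base A N C M Fo Fa Ga \<eta> \<B> X = unit_map A N C M Fa Ga \<eta> X ` \<B> (Fo X)"

end

theory Submission
  imports Defs
begin

text \<open>For every arrow \<open>h\<close> into \<open>X\<close> and every subobject \<open>L\<close> of \<open>F X\<close>, the arrow \<open>\<eta>\<^sub>X \<odot> h\<close> factors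
  through \<open>G L\<close> iff \<open>F h\<close> factors through \<open>L\<close>.  So \<open>L \<mapsto> \<eta>\<^sub>X\<inverse>(G L)\<close> is right adjoint to
  \<open>K \<mapsto> F K\<close> on subobjects, and \<open>U\<^sup>\<eta>\<close> is the conjugate of \<open>U\<close> by this Galois connection; the axioms
  (U1), (U2), (U4), the continuity of \<open>F\<close> and the minimality are then order-theoretic.  For (U5) one
  applies the equivalence to \<open>f \<odot> n\<close>, where \<open>n\<close> represents \<open>U\<^sup>\<eta>(K)\<close>, so that it
  suffices to compare the image of \<open>F K\<close> under \<open>F f\<close> with \<open>F (f K)\<close> in the direction that holds for every functor preserving subobjects.\<close>

section \<open>Arrows of a category and factoring of one arrow through another\<close>

lemma HomI: "\<lbrakk>f \<in> Arr C; Dom C f = X; Cod C f = Y\<rbrakk> \<Longrightarrow> f \<in> Hom C X Y"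
  by (simp add: Hom_def)

lemma Hom_Arr: "f \<in> Hom C X Y \<Longrightarrow> f \<in> Arr C"
  and Hom_Dom: "f \<in> Hom C X Y \<Longrightarrow> Dom C f = X"
  and Hom_Cod: "f \<in> Hom C X Y \<Longrightarrow> Cod C f = Y"
  by (simp_all add: Hom_def)

lemmas HomD = Hom_Arr Hom_Dom Hom_Cod

text \<open>The arrow \<open>f\<close> need not belong to \<open>M\<close>: composites such as
  \<open>f \<odot> m\<close> are compared with a subobject before any factorization of them is
  taken.\<close>

definition factors_through :: "('o, 'a) cat_data \<Rightarrow> 'a \<Rightarrow> 'a set \<Rightarrow> bool" where
  "factors_through C f K \<longleftrightarrow> (\<exists>k \<in> K. arr_le C f k)"

context category
begin

lemma arr_le_refl: "f \<in> Arr C \<Longrightarrow> arr_le C f f"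
  unfolding arr_le_def
  by (metis HomI dom_obj ident_hom ident_right)

text \<open>\<open>arr_le\<close> does not ask for a common codomain; it is forced, because
  \<open>f\<close> is a composite \<open>g \<odot> j\<close>.\<close>

lemma arr_le_Cod:
  assumes "arr_le C f g" "g \<in> Arr C"
  shows "Cod C f = Cod C g"
  using assms comp_hom unfolding arr_le_def by (metis HomD(3) HomI)

lemma arr_le_trans:
  assumes "arr_le C f g" "arr_le C g h" "h \<in> Arr C"
  shows "arr_le C f h"
proof -
  obtain i where i: "i \<in> Hom C (Dom C f) (Dom C g)" "g \<odot> i = f"
    using assms(1) unfolding arr_le_def by blast
  obtain j where j: "j \<in> Hom C (Dom C g) (Dom C h)" "h \<odot> j = g"
    using assms(2) unfolding arr_le_def by blast
  have "h \<odot> (j \<odot> i) = f"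
    using i j comp_assoc[OF i(1) j(1) HomI[OF assms(3)]] by simp
  then show ?thesis
    using comp_hom[OF i(1) j(1)] unfolding arr_le_def by blast
qed

lemma arr_le_comp:
  assumes "j \<in> Hom C X Y" "m \<in> Hom C Y Z"
  shows "arr_le C (m \<odot> j) m"
  using assms comp_hom[OF assms] unfolding arr_le_def by (metis HomD(2))

lemma arr_le_comp_left:
  assumes "arr_le C f g" "g \<in> Hom C X Y" "h \<in> Hom C Y Z"
  shows "arr_le C (h \<odot> f) (h \<odot> g)"
proof -
  obtain i where i: "i \<in> Hom C (Dom C f) X" "g \<odot> i = f"
    using assms unfolding arr_le_def by (metis HomD(2))
  have "(h \<odot> g) \<odot> i = h \<odot> f"
    using comp_assoc[OF i(1) assms(2,3)] i by simp
  then show ?thesis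
    using arr_le_comp[OF i(1) comp_hom[OF assms(2,3)]] by simp
qed

text \<open>The commuting square gives one direction; the universal property, which turns a
  factorization of \<open>f \<odot> u\<close> through \<open>n\<close> into one of \<open>u\<close>
  through \<open>p\<close>, gives the other. So \<open>n\<close> and \<open>f\<close> determine
  which arrows factor through \<open>p\<close>.\<close>

lemma pullback_factors:
  assumes "is_pullback C f n p q" "u \<in> Hom C Z (Dom C f)"
  shows "arr_le C u p \<longleftrightarrow> arr_le C (f \<odot> u) n"
proof -
  have f: "f \<in> Hom C (Dom C f) (Cod C n)" and n: "n \<in> Hom C (Dom C n) (Cod C n)"
    and p: "p \<in> Hom C (Dom C p) (Dom C f)" and q: "q \<in> Hom C (Dom C p) (Dom C n)"
    and sq: "f \<odot> p = n \<odot> q"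
    using assms(1) unfolding is_pullback_def by (auto intro: HomI)
  have fu: "f \<odot> u \<in> Hom C Z (Cod C n)" using comp_hom[OF assms(2) f] .
  show ?thesis
  proof
    assume "arr_le C u p"
    then have "arr_le C (f \<odot> u) (f \<odot> p)" using arr_le_comp_left p f by blast
    moreover have "arr_le C (f \<odot> p) n" unfolding sq using arr_le_comp q n by blast
    ultimately show "arr_le C (f \<odot> u) n" using arr_le_trans n HomD(1) by metis
  next
    assume "arr_le C (f \<odot> u) n"
    then obtain v where "v \<in> Hom C Z (Dom C n)" "n \<odot> v = f \<odot> u"
      unfolding arr_le_def HomD(2)[OF fu] by blast
    then obtain w where "w \<in> Hom C Z (Dom C p)" "p \<odot> w = u"
      using assms unfolding is_pullback_def by metis
    then show "arr_le C u p" unfolding arr_le_def HomD(2)[OF assms(2)] by blast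
  qed
qed

end

section \<open>The ordered set of subobjects and its binary meets\<close>

lemma carrier_Sub: "carrier (Sub C M X) = sub_class C M ` {m \<in> M. Cod C m = X}"
  and le_Sub: "K \<sqsubseteq>\<^bsub>Sub C M X\<^esub> L \<longleftrightarrow> (\<exists>n \<in> K. \<exists>m \<in> L. arr_le C n m)"
  and eq_Sub: "K .=\<^bsub>Sub C M X\<^esub> L \<longleftrightarrow> K = L"
  by (simp_all add: Sub_def)

text \<open>Collects what holds in both categories of the theorem, so that the following facts can
  be instantiated for \<open>C\<close> and for \<open>A\<close>.\<close>

locale subobject_lattices = factorization_system C E M + M_complete C M
  for C :: "('o, 'a) cat_data" (structure) and E M :: "'a set"
begin

lemma sub_class_self: "m \<in> M \<Longrightarrow> m \<in> sub_class C M m"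
  using arr_le_refl M_arr unfolding sub_class_def by blast

lemma sub_class_eq:
  assumes "arr_le C m n" "arr_le C n m" "m \<in> Arr C" "n \<in> Arr C"
  shows "sub_class C M m = sub_class C M n"
proof -
  have "k \<in> sub_class C M m \<longleftrightarrow> k \<in> sub_class C M n" for k
    using arr_le_Cod[OF assms(1,4)] arr_le_trans[OF _ assms(1,4), of k]
      arr_le_trans[OF _ assms(2,3), of k] arr_le_trans[OF assms(1), of k]
      arr_le_trans[OF assms(2), of k] M_arr
    by (auto simp: sub_class_def)
  then show ?thesis by blast
qed

lemma sub_class_carrier: "\<lbrakk>m \<in> M; Cod C m = X\<rbrakk> \<Longrightarrow> sub_class C M m \<in> carrier (Sub C M X)"
  unfolding carrier_Sub by blast

lemma carrierE:
  assumes "K \<in> carrier (Sub C M X)"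
  obtains m where "m \<in> M" "m \<in> Hom C (Dom C m) X" "m \<in> K" "K = sub_class C M m"
  using assms sub_class_self M_arr unfolding carrier_Sub by (auto intro: HomI)

lemma carrier_mem:
  assumes "K \<in> carrier (Sub C M X)" "k \<in> K"
  shows "k \<in> M" "k \<in> Arr C" "Cod C k = X" "k \<in> Hom C (Dom C k) X" "sub_class C M k = K"
proof -
  obtain m where m: "m \<in> M" "m \<in> Hom C (Dom C m) X" "K = sub_class C M m"
    using assms(1) by (rule carrierE)
  show 1: "k \<in> M" and 2: "Cod C k = X"
    using m assms(2) by (auto simp: sub_class_def HomD)
  then show 3: "k \<in> Arr C" and "k \<in> Hom C (Dom C k) X"
    using M_arr by (auto intro: HomI)
  show "sub_class C M k = K"
    unfolding m(3)
    by (rule sub_class_eq) (use m assms(2) 3 in \<open>auto simp: sub_class_def HomD\<close>)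
qed

text \<open>Members of one class factor through each other, so the existential in
  \<open>factors_through\<close> may be tested on any chosen representative.\<close>

lemma factors_iff:
  assumes "K \<in> carrier (Sub C M X)" "k \<in> K"
  shows "factors_through C f K \<longleftrightarrow> arr_le C f k"
proof
  assume "factors_through C f K"
  then obtain m where m: "m \<in> K" "arr_le C f m" unfolding factors_through_def by blast
  moreover have "arr_le C m k"
    using carrier_mem(5)[OF assms] m(1) unfolding sub_class_def by blast
  ultimately show "arr_le C f k" using arr_le_trans carrier_mem(2)[OF assms] by blast
qed (use assms(2) in \<open>auto simp: factors_through_def\<close>)

lemma factors_comp:
  assumes "K \<in> carrier (Sub C M X)" "factors_through C f K" "arr_le C g f"
  shows "factors_through C g K"
  using assms arr_le_trans carrier_mem(2)[OF assms(1)] unfolding factors_through_def by blast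

lemma le_iff_factors:
  assumes "K \<in> carrier (Sub C M X)" "L \<in> carrier (Sub C M X)" "k \<in> K"
  shows "K \<sqsubseteq>\<^bsub>Sub C M X\<^esub> L \<longleftrightarrow> factors_through C k L"
proof
  assume "K \<sqsubseteq>\<^bsub>Sub C M X\<^esub> L"
  then obtain n where "n \<in> K" "factors_through C n L"
    unfolding le_Sub factors_through_def by blast
  moreover have "arr_le C k n"
    using carrier_mem(5)[OF assms(1) \<open>n \<in> K\<close>] assms(3) unfolding sub_class_def by blast
  ultimately show "factors_through C k L" using factors_comp assms by blast
qed (use assms(3) in \<open>auto simp: le_Sub factors_through_def\<close>)

lemma factors_le:
  assumes "K \<in> carrier (Sub C M X)" "L \<in> carrier (Sub C M X)" "K \<sqsubseteq>\<^bsub>Sub C M X\<^esub> L"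
    and "factors_through C f K"
  shows "factors_through C f L"
proof -
  obtain k where "k \<in> K" "arr_le C f k" using assms(4) unfolding factors_through_def by blast
  then show ?thesis using assms le_iff_factors factors_comp by blast
qed

lemma Sub_refl: "K \<in> carrier (Sub C M X) \<Longrightarrow> K \<sqsubseteq>\<^bsub>Sub C M X\<^esub> K"
  by (metis carrierE carrier_mem(2) factors_iff arr_le_refl le_iff_factors)

lemma Sub_trans:
  assumes "K \<in> carrier (Sub C M X)" "L \<in> carrier (Sub C M X)" "N \<in> carrier (Sub C M X)"
    and "K \<sqsubseteq>\<^bsub>Sub C M X\<^esub> L" "L \<sqsubseteq>\<^bsub>Sub C M X\<^esub> N"
  shows "K \<sqsubseteq>\<^bsub>Sub C M X\<^esub> N"
  using assms by (metis carrierE factors_le le_iff_factors)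

text \<open>An equality of sets, since a subobject is its whole class of mutually factoring
  arrows.\<close>

lemma Sub_antisym:
  assumes "K \<in> carrier (Sub C M X)" "L \<in> carrier (Sub C M X)"
    and "K \<sqsubseteq>\<^bsub>Sub C M X\<^esub> L" "L \<sqsubseteq>\<^bsub>Sub C M X\<^esub> K"
  shows "K = L"
proof -
  obtain k l where "k \<in> K" "l \<in> L" using assms carrierE by metis
  then show ?thesis
    using assms le_iff_factors factors_iff carrier_mem sub_class_eq by metis
qed

lemma partial_order_Sub: "partial_order (Sub C M X)"
  by unfold_locales (auto simp: eq_Sub fun_eq_iff intro: Sub_refl Sub_trans dest: Sub_antisym)

text \<open>The meet is the class of the \<open>M\<close>-intersection of two representatives. Its
  universal property concerns all arrows into \<open>X\<close>, in particular representatives of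
  lower bounds.\<close>

lemma lower_semilattice_Sub:
  assumes "X \<in> Obj C"
  shows "lower_semilattice (Sub C M X)"
proof -
  interpret partial_order "Sub C M X" by (rule partial_order_Sub)
  show ?thesis
  proof
    fix K L assume K: "K \<in> carrier (Sub C M X)" and L: "L \<in> carrier (Sub C M X)"
    obtain k l where k: "k \<in> K" and l: "l \<in> L" using K L carrierE by metis
    note km = carrier_mem[OF K k] and lm = carrier_mem[OF L l]
    obtain i where i: "i \<in> M" "Cod C i = X" "arr_le C i k" "arr_le C i l"
      and glb: "\<And>f. \<lbrakk>f \<in> Arr C; Cod C f = X; arr_le C f k; arr_le C f l\<rbrakk> \<Longrightarrow> arr_le C f i"
      using intersections[of X "{k, l}"] assms km lm by auto
    let ?I = "sub_class C M i"
    have I: "?I \<in> carrier (Sub C M X)" and iI: "i \<in> ?I"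
      using i sub_class_carrier sub_class_self by auto
    have "greatest (Sub C M X) ?I (Lower (Sub C M X) {K, L})"
    proof (rule greatest_LowerI)
      show "?I \<sqsubseteq>\<^bsub>Sub C M X\<^esub> N" if "N \<in> {K, L}" for N
        using that I iI K L k l i le_iff_factors factors_iff by auto
      show "N \<sqsubseteq>\<^bsub>Sub C M X\<^esub> ?I" if N: "N \<in> Lower (Sub C M X) {K, L}" for N
      proof -
        have N': "N \<in> carrier (Sub C M X)" and le: "N \<sqsubseteq>\<^bsub>Sub C M X\<^esub> K" "N \<sqsubseteq>\<^bsub>Sub C M X\<^esub> L"
          using N K L by (auto simp: Lower_def)
        obtain n where n: "n \<in> N" using N' by (rule carrierE)
        have "arr_le C n i"
          using le N' K L k l n by (auto intro!: glb carrier_mem simp: le_iff_factors factors_iff)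
        then show ?thesis using N' I n iI le_iff_factors factors_iff by blast
      qed
    qed (use K L I in auto)
    then show "\<exists>s. greatest (Sub C M X) s (Lower (Sub C M X) {K, L})" by blast
  qed
qed

lemma meet_Sub:
  assumes "X \<in> Obj C" "K \<in> carrier (Sub C M X)" "L \<in> carrier (Sub C M X)"
  shows "K \<sqinter>\<^bsub>Sub C M X\<^esub> L \<in> carrier (Sub C M X)"
    and "N \<in> carrier (Sub C M X) \<Longrightarrow>
         N \<sqsubseteq>\<^bsub>Sub C M X\<^esub> K \<sqinter>\<^bsub>Sub C M X\<^esub> L \<longleftrightarrow> N \<sqsubseteq>\<^bsub>Sub C M X\<^esub> K \<and> N \<sqsubseteq>\<^bsub>Sub C M X\<^esub> L"
proof -
  interpret lower_semilattice "Sub C M X" by (rule lower_semilattice_Sub[OF assms(1)])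
  show c: "K \<sqinter>\<^bsub>Sub C M X\<^esub> L \<in> carrier (Sub C M X)" using assms by simp
  show "N \<sqsubseteq>\<^bsub>Sub C M X\<^esub> K \<sqinter>\<^bsub>Sub C M X\<^esub> L \<longleftrightarrow> N \<sqsubseteq>\<^bsub>Sub C M X\<^esub> K \<and> N \<sqsubseteq>\<^bsub>Sub C M X\<^esub> L"
    if N: "N \<in> carrier (Sub C M X)"
    using Sub_trans[OF N c assms(2) _ meet_left[OF assms(2,3)]]
      Sub_trans[OF N c assms(3) _ meet_right[OF assms(2,3)]]
      meet_le[OF _ _ assms(2,3) N] by (intro iffI conjI) simp_all
qed

section \<open>Preimages and images of subobjects\<close>

lemma sub_preimage:
  assumes "f \<in> Hom C X Y" "L \<in> carrier (Sub C M Y)"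
  shows sub_preimage_carrier: "sub_preimage C M f L \<in> carrier (Sub C M X)"
    and factors_sub_preimage:
      "u \<in> Hom C Z X \<Longrightarrow> factors_through C u (sub_preimage C M f L) \<longleftrightarrow> factors_through C (f \<odot> u) L"
proof -
  obtain n where n: "n \<in> L" using assms(2) by (rule carrierE)
  obtain p q where p: "p \<in> M" and pb: "is_pullback C f n p q"
    using pullbacks[of n f] carrier_mem[OF assms(2) n] HomD[OF assms(1)] by auto
  have pullback_hom: "p' \<in> Hom C (Dom C p') X" and
    pullback_iff: "\<And>Z u. u \<in> Hom C Z X \<Longrightarrow> arr_le C u p' \<longleftrightarrow> factors_through C (f \<odot> u) L"
    if "n' \<in> L" "is_pullback C f n' p' q'" for n' p' q'
  proof -
    show "p' \<in> Hom C (Dom C p') X"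
      using that HomD[OF assms(1)] by (auto simp: is_pullback_def)
    show "arr_le C u p' \<longleftrightarrow> factors_through C (f \<odot> u) L" if "u \<in> Hom C Z X" for Z u
      using pullback_factors[OF \<open>is_pullback C f n' p' q'\<close>] that HomD[OF assms(1)]
        factors_iff[OF assms(2) \<open>n' \<in> L\<close>] by metis
  qed
  \<comment> \<open>By \<open>pullback_iff\<close>, the same arrows factor through \<open>p\<close>
    and \<open>p'\<close>. Each of the two factors through itself, hence through the other, so the
    union defining \<open>sub_preimage\<close> is a single class.\<close>
  have "sub_class C M p' = sub_class C M p" if "n' \<in> L" "is_pullback C f n' p' q'" for n' p' q'
    using pullback_hom[OF that] pullback_iff[OF that] pullback_hom[OF n pb] pullback_iff[OF n pb]
      sub_class_eq arr_le_refl HomD(1) by metis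
  then have eq: "sub_preimage C M f L = sub_class C M p"
    using n pb unfolding sub_preimage_def by blast
  show c: "sub_preimage C M f L \<in> carrier (Sub C M X)"
    unfolding eq using p pullback_hom[OF n pb] by (auto intro: sub_class_carrier simp: HomD)
  show "factors_through C u (sub_preimage C M f L) \<longleftrightarrow> factors_through C (f \<odot> u) L"
    if "u \<in> Hom C Z X"
    using factors_iff[OF c, of p] sub_class_self[OF p] pullback_iff[OF n pb that] eq by simp
qed

text \<open>A factorization of \<open>k \<odot> e\<close> through \<open>l\<close> gives a commuting
  square from \<open>e\<close> to \<open>l\<close>, whose diagonal factors \<open>k\<close> through
  \<open>l\<close>. Hence \<open>k\<close> represents the least subobject through which
  \<open>k \<odot> e\<close> factors.\<close>

lemma factorization_le:
  assumes "e \<in> E" "k \<in> M" "Cod C e = Dom C k" "l \<in> M"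
  shows "arr_le C (k \<odot> e) l \<longleftrightarrow> arr_le C k l"
proof
  have e: "e \<in> Hom C (Dom C e) (Dom C k)" and k: "k \<in> Hom C (Dom C k) (Cod C k)"
    using assms E_arr M_arr by (auto intro: HomI)
  note ke = comp_hom[OF e k]
  { assume le: "arr_le C (k \<odot> e) l"
    then obtain u where u: "u \<in> Hom C (Dom C e) (Dom C l)" "l \<odot> u = k \<odot> e"
      unfolding arr_le_def HomD(2)[OF ke] by blast
    have "Cod C l = Cod C k" using arr_le_Cod[OF le] assms M_arr HomD(3)[OF ke] by auto
    then obtain d where "d \<in> Hom C (Dom C k) (Dom C l)" "l \<odot> d = k"
      using diagonal[OF assms(1,4) u(1), of k] k u(2) assms(3) by auto
    then show "arr_le C k l" unfolding arr_le_def by blast }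
  assume "arr_le C k l"
  then show "arr_le C (k \<odot> e) l"
    using arr_le_comp[OF e k] arr_le_trans assms M_arr by blast
qed

text \<open>Different representatives \<open>m\<close> of \<open>K\<close> give composites
  \<open>f \<odot> m\<close> that factor through one another; by \<open>factorization_le\<close> so
  do their \<open>M\<close>-parts. The image is therefore one class, the least subobject through
  which any of these composites factors.\<close>

lemma sub_image:
  assumes "f \<in> Hom C X Y" "K \<in> carrier (Sub C M X)"
  shows sub_image_carrier: "sub_image C E M f K \<in> carrier (Sub C M Y)"
    and factors_sub_image: "m \<in> K \<Longrightarrow> factors_through C (f \<odot> m) (sub_image C E M f K)"
    and sub_image_le: "\<lbrakk>m \<in> K; L \<in> carrier (Sub C M Y); factors_through C (f \<odot> m) L\<rbrakk>
                       \<Longrightarrow> sub_image C E M f K \<sqsubseteq>\<^bsub>Sub C M Y\<^esub> L"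
proof -
  obtain m where m: "m \<in> K" using assms(2) by (rule carrierE)
  have fm: "f \<odot> m' \<in> Hom C (Dom C m') Y" if "m' \<in> K" for m'
    using comp_hom carrier_mem(4)[OF assms(2) that] assms(1) by blast
  obtain e k where ek: "e \<in> E" "k \<in> M" "Cod C e = Dom C k" "f \<odot> m = k \<odot> e"
    using factorization[OF HomD(1)[OF fm[OF m]]] by blast
  have comp_le: "arr_le C (f \<odot> m1) (f \<odot> m2)" if "m1 \<in> K" "m2 \<in> K" for m1 m2
    using that assms carrier_mem[OF assms(2)] factors_iff arr_le_comp_left
      le_iff_factors Sub_refl by metis
  have img: "k' \<in> Hom C (Dom C k') Y" "sub_class C M k' = sub_class C M k" 
    if k': "m' \<in> K" "e' \<in> E" "k' \<in> M" "Cod C e' = Dom C k'" "f \<odot> m' = k' \<odot> e'" for m' e' k'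
  proof -
    have arr: "k \<in> Arr C" "k' \<in> Arr C" "e' \<in> Arr C" using ek k' M_arr E_arr by auto
    have "k' \<odot> e' \<in> Hom C (Dom C e') (Cod C k')"
      using comp_hom[OF HomI HomI] arr k'(4) by metis
    then show "k' \<in> Hom C (Dom C k') Y"
      using arr fm[OF k'(1)] k'(5) by (metis HomD(3) HomI)
    have refl: "arr_le C k k" "arr_le C k' k'" using arr arr_le_refl by auto
    have "arr_le C (k \<odot> e) k" "arr_le C (k' \<odot> e') k'"
      using factorization_le ek k' refl by blast+
    then have "arr_le C (k' \<odot> e') k" "arr_le C (k \<odot> e) k'"
      using comp_le m k'(1,5) ek(4) arr_le_trans arr by metis+
    then show "sub_class C M k' = sub_class C M k"
      using sub_class_eq factorization_le ek k' arr by blast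
  qed
  have eq: "sub_image C E M f K = sub_class C M k"
    using img(2) m ek unfolding sub_image_def by blast
  show c: "sub_image C E M f K \<in> carrier (Sub C M Y)"
    unfolding eq using img(1)[OF m ek] ek(2) by (auto intro: sub_class_carrier simp: HomD)
  have kI: "k \<in> sub_image C E M f K" unfolding eq using sub_class_self ek by blast
  show "factors_through C (f \<odot> m') (sub_image C E M f K)" if "m' \<in> K" for m'
  proof -
    have "arr_le C (f \<odot> m) k"
      using factorization_le[OF ek(1-3) ek(2)] ek arr_le_refl M_arr by auto
    then have "arr_le C (f \<odot> m') k"
      using comp_le[OF that m] arr_le_trans ek M_arr by blast
    then show ?thesis using factors_iff[OF c kI] by blast
  qed
  show "sub_image C E M f K \<sqsubseteq>\<^bsub>Sub C M Y\<^esub> L"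
    if m': "m' \<in> K" and L: "L \<in> carrier (Sub C M Y)" and fac: "factors_through C (f \<odot> m') L"
    for m' L
  proof -
    obtain l where l: "l \<in> L" using L by (rule carrierE)
    have "factors_through C (f \<odot> m) L" using m' L fac comp_le m factors_comp by blast
    then have "arr_le C k l"
      using factors_iff[OF L l] factorization_le ek carrier_mem(1)[OF L l] by metis
    then show ?thesis
      using le_iff_factors[OF c L kI] factors_iff[OF L l] by blast
  qed
qed

section \<open>Monotone self-maps and the quasi-uniformity generated by a base\<close>

lemma monotone_maps_Sub:
  "U \<in> monotone_maps (Sub C M X) \<longleftrightarrow>
     U \<in> carrier (Sub C M X) \<rightarrow>\<^sub>E carrier (Sub C M X) \<and>
     (\<forall>K \<in> carrier (Sub C M X). \<forall>L \<in> carrier (Sub C M X).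
        K \<sqsubseteq>\<^bsub>Sub C M X\<^esub> L \<longrightarrow> U K \<sqsubseteq>\<^bsub>Sub C M X\<^esub> U L)"
proof -
  \<comment> \<open>\<open>isotone\<close> also requires both orders to be weak partial orders; the
    interpretation supplies this, leaving only monotonicity.\<close>
  interpret partial_order "Sub C M X" by (rule partial_order_Sub)
  show ?thesis
    unfolding monotone_maps_def isotone_def using weak_partial_order_axioms by auto
qed

lemma monotone_maps_carrier:
  "\<lbrakk>U \<in> monotone_maps (Sub C M X); K \<in> carrier (Sub C M X)\<rbrakk> \<Longrightarrow> U K \<in> carrier (Sub C M X)"
  unfolding monotone_maps_Sub by blast

lemma monotone_maps_mono:
  "\<lbrakk>U \<in> monotone_maps (Sub C M X); K \<in> carrier (Sub C M X); L \<in> carrier (Sub C M X);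
    K \<sqsubseteq>\<^bsub>Sub C M X\<^esub> L\<rbrakk> \<Longrightarrow> U K \<sqsubseteq>\<^bsub>Sub C M X\<^esub> U L"
  unfolding monotone_maps_Sub by blast

text \<open>The pointwise meet is described by the lower bounds of its values, the form in which it
  can be compared with maps defined through a right adjoint.\<close>

lemma map_meet_Sub:
  assumes "X \<in> Obj C" "U \<in> monotone_maps (Sub C M X)" "V \<in> monotone_maps (Sub C M X)"
  shows map_meet_monotone: "map_meet (Sub C M X) U V \<in> monotone_maps (Sub C M X)"
    and le_map_meet: "\<lbrakk>K \<in> carrier (Sub C M X); N \<in> carrier (Sub C M X)\<rbrakk> \<Longrightarrow>
           N \<sqsubseteq>\<^bsub>Sub C M X\<^esub> map_meet (Sub C M X) U V K \<longleftrightarrow>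
           N \<sqsubseteq>\<^bsub>Sub C M X\<^esub> U K \<and> N \<sqsubseteq>\<^bsub>Sub C M X\<^esub> V K"
proof -
  note c = monotone_maps_carrier[OF assms(2)] monotone_maps_carrier[OF assms(3)]
  have 1: "map_meet (Sub C M X) U V K \<in> carrier (Sub C M X)" if "K \<in> carrier (Sub C M X)" for K
    using that c meet_Sub(1)[OF assms(1)] unfolding map_meet_def by simp
  have 2: "N \<sqsubseteq>\<^bsub>Sub C M X\<^esub> map_meet (Sub C M X) U V K \<longleftrightarrow>
           N \<sqsubseteq>\<^bsub>Sub C M X\<^esub> U K \<and> N \<sqsubseteq>\<^bsub>Sub C M X\<^esub> V K"
    if "K \<in> carrier (Sub C M X)" "N \<in> carrier (Sub C M X)" for K N
    using that c meet_Sub(2)[OF assms(1)] unfolding map_meet_def by simp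
  show "N \<sqsubseteq>\<^bsub>Sub C M X\<^esub> map_meet (Sub C M X) U V K \<longleftrightarrow>
           N \<sqsubseteq>\<^bsub>Sub C M X\<^esub> U K \<and> N \<sqsubseteq>\<^bsub>Sub C M X\<^esub> V K"
    if "K \<in> carrier (Sub C M X)" "N \<in> carrier (Sub C M X)"
    using 2 that by blast
  show "map_meet (Sub C M X) U V \<in> monotone_maps (Sub C M X)"
    unfolding monotone_maps_Sub
  proof (intro conjI ballI impI)
    show "map_meet (Sub C M X) U V \<in> carrier (Sub C M X) \<rightarrow>\<^sub>E carrier (Sub C M X)"
      using 1 by (auto simp: map_meet_def)
  next
    fix K L assume K: "K \<in> carrier (Sub C M X)" and L: "L \<in> carrier (Sub C M X)"
      and le: "K \<sqsubseteq>\<^bsub>Sub C M X\<^esub> L"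
    let ?W = "map_meet (Sub C M X) U V"
    have "?W K \<sqsubseteq>\<^bsub>Sub C M X\<^esub> U K" "?W K \<sqsubseteq>\<^bsub>Sub C M X\<^esub> V K"
      using 2[OF K 1[OF K]] Sub_refl[OF 1[OF K]] by auto
    then show "?W K \<sqsubseteq>\<^bsub>Sub C M X\<^esub> ?W L"
      using 2[OF L 1[OF K]] monotone_maps_mono[OF assms(2) K L le]
        monotone_maps_mono[OF assms(3) K L le]
        Sub_trans[OF 1[OF K] c(1)[OF K] c(1)[OF L]] Sub_trans[OF 1[OF K] c(2)[OF K] c(2)[OF L]]
      by blast
  qed
qed

text \<open>A generated map lies above a member of the base and inherits its properties by
  transitivity. The witnesses for (U2) and (U5) are taken from the base, which lies in the generated
  family by reflexivity; for (U4) the meet of two base members lies below the meet of the maps above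
  them.\<close>

lemma quasi_uniformity_generated:
  assumes "quasi_uniformity_base C E M \<B>"
  shows "quasi_uniformity C E M (generated_qu C M \<B>)"
proof -
  interpret B: quasi_uniformity_base C E M \<B> by fact
  note mono = subsetD[OF B.monotone]
  note car = monotone_maps_carrier
  show ?thesis
  proof
    fix X assume X: "X \<in> Obj C"
    show "generated_qu C M \<B> X \<subseteq> monotone_maps (Sub C M X)"
      unfolding generated_qu_def by blast
    fix U assume U: "U \<in> generated_qu C M \<B> X"
    then obtain V where V: "V \<in> \<B> X" "map_le (Sub C M X) V U"
      and Um: "U \<in> monotone_maps (Sub C M X)"
      unfolding generated_qu_def by blast
    note Vm = mono[OF X V(1)]
    show "K \<sqsubseteq>\<^bsub>Sub C M X\<^esub> U K" if K: "K \<in> carrier (Sub C M X)" for K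
      using B.U1[OF X V(1) K] V(2) K car[OF Um K] car[OF Vm K] Sub_trans
      unfolding map_le_def by blast
    obtain V' where V': "V' \<in> \<B> X" "map_le (Sub C M X) (V' \<circ> V') V" using B.U2 X V(1) by blast
    note V'm = mono[OF X V'(1)]
    have "map_le (Sub C M X) (V' \<circ> V') U"
      unfolding map_le_def comp_apply
    proof
      fix K assume K: "K \<in> carrier (Sub C M X)"
      show "V' (V' K) \<sqsubseteq>\<^bsub>Sub C M X\<^esub> U K"
        using V(2) V'(2) K Sub_trans[OF car[OF V'm car[OF V'm K]] car[OF Vm K] car[OF Um K]]
        unfolding map_le_def by simp
    qed
    moreover have "V' \<in> generated_qu C M \<B> X"
      using V'(1) V'm Sub_refl car[OF V'm] unfolding generated_qu_def map_le_def by blast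
    ultimately show "\<exists>U' \<in> generated_qu C M \<B> X. map_le (Sub C M X) (U' \<circ> U') U" by blast
    show "U' \<in> generated_qu C M \<B> X"
      if "U' \<in> monotone_maps (Sub C M X)" "map_le (Sub C M X) U U'" for U'
    proof -
      have "map_le (Sub C M X) V U'"
        using that(2) V(2) Sub_trans[OF car[OF Vm] car[OF Um] car[OF that(1)]]
        unfolding map_le_def by simp
      then show ?thesis using that(1) V(1) unfolding generated_qu_def by blast
    qed
    fix U' assume "U' \<in> generated_qu C M \<B> X"
    then obtain W where W: "W \<in> \<B> X" "map_le (Sub C M X) W U'"
      and U'm: "U' \<in> monotone_maps (Sub C M X)"
      unfolding generated_qu_def by blast
    note Wm = mono[OF X W(1)]
    let ?VW = "map_meet (Sub C M X) V W" and ?UU' = "map_meet (Sub C M X) U U'"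
    have VW: "?VW \<in> \<B> X" using B.U4 X V W by blast
    have "?VW K \<sqsubseteq>\<^bsub>Sub C M X\<^esub> ?UU' K" if K: "K \<in> carrier (Sub C M X)" for K
    proof -
      have c: "?VW K \<in> carrier (Sub C M X)" using car mono X VW K by blast
      then have "?VW K \<sqsubseteq>\<^bsub>Sub C M X\<^esub> V K" "?VW K \<sqsubseteq>\<^bsub>Sub C M X\<^esub> W K"
        using le_map_meet[OF X Vm Wm K] Sub_refl by blast+
      then show ?thesis
        using le_map_meet[OF X Um U'm K c] V(2) W(2) K
          Sub_trans[OF c car[OF Vm K] car[OF Um K]] Sub_trans[OF c car[OF Wm K] car[OF U'm K]]
        unfolding map_le_def by blast
    qed
    then show "?UU' \<in> generated_qu C M \<B> X"
      using VW map_meet_monotone[OF X Um U'm] unfolding generated_qu_def map_le_def by blast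
  next
    fix f X Y U assume f: "f \<in> Hom C X Y" and "U \<in> generated_qu C M \<B> Y"
    then obtain V where V: "V \<in> \<B> Y" "map_le (Sub C M Y) V U"
      and Um: "U \<in> monotone_maps (Sub C M Y)"
      unfolding generated_qu_def by blast
    have X: "X \<in> Obj C" and Y: "Y \<in> Obj C" using f dom_obj cod_obj by (auto simp: Hom_def)
    obtain V' where V': "V' \<in> \<B> X" and le: "\<And>K. K \<in> carrier (Sub C M X) \<Longrightarrow>
        sub_image C E M f (V' K) \<sqsubseteq>\<^bsub>Sub C M Y\<^esub> V (sub_image C E M f K)"
      using B.U5 f V(1) by blast
    note V'm = mono[OF X V'] and Vm = mono[OF Y V(1)]
    have "V' \<in> generated_qu C M \<B> X"
      using V' V'm Sub_refl car[OF V'm] unfolding generated_qu_def map_le_def by blast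
    moreover have "sub_image C E M f (V' K) \<sqsubseteq>\<^bsub>Sub C M Y\<^esub> U (sub_image C E M f K)"
      if K: "K \<in> carrier (Sub C M X)" for K
    proof -
      note fK = sub_image_carrier[OF f K]
      show ?thesis
        using le[OF K] V(2) fK Sub_trans[OF sub_image_carrier[OF f car[OF V'm K]]
            car[OF Vm fK] car[OF Um fK]]
        unfolding map_le_def by blast
    qed
    ultimately show "\<exists>U' \<in> generated_qu C M \<B> X. \<forall>K \<in> carrier (Sub C M X).
        sub_image C E M f (U' K) \<sqsubseteq>\<^bsub>Sub C M Y\<^esub> U (sub_image C E M f K)" by blast
  qed
qed

end

section \<open>Functors that preserve subobjects\<close>

locale subobject_functor =
  A: subobject_lattices A E' M' + C: subobject_lattices C E M
  for A :: "('p, 'b) cat_data" and E' M' :: "'b set"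
    and C :: "('o, 'a) cat_data" and E M :: "'a set" +
  fixes Fo :: "'p \<Rightarrow> 'o" and Fa :: "'b \<Rightarrow> 'a"
  assumes is_functor: "is_functor A C Fo Fa"
    and preserves: "preserves_subobjects M' M Fa"
begin

lemma F_Obj: "X \<in> Obj A \<Longrightarrow> Fo X \<in> Obj C"
  and F_Hom: "f \<in> Hom A X Y \<Longrightarrow> Fa f \<in> Hom C (Fo X) (Fo Y)"
  and F_comp: "\<lbrakk>f \<in> Hom A X Y; g \<in> Hom A Y Z\<rbrakk> \<Longrightarrow> Fa (g \<odot>\<^bsub>A\<^esub> f) = Fa g \<odot>\<^bsub>C\<^esub> Fa f"
  using is_functor unfolding is_functor_def by blast+

lemma F_arr_le:
  assumes "arr_le A f g" "f \<in> Arr A" "g \<in> Arr A"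
  shows "arr_le C (Fa f) (Fa g)"
proof -
  obtain j where j: "j \<in> Hom A (Dom A f) (Dom A g)" "g \<odot>\<^bsub>A\<^esub> j = f"
    using assms(1) unfolding arr_le_def by blast
  have g: "g \<in> Hom A (Dom A g) (Cod A g)" using assms(3) by (auto intro: HomI)
  show ?thesis
    using C.arr_le_comp[OF F_Hom[OF j(1)] F_Hom[OF g]] F_comp[OF j(1) g] j(2) by simp
qed

text \<open>A functor preserves factoring, so the images of all representatives of \<open>K\<close>
  belong to one class; \<open>preserves\<close> puts them into \<open>M\<close>.\<close>

lemma sub_map:
  assumes "K \<in> carrier (Sub A M' X)"
  shows sub_map_carrier: "sub_map C M Fa K \<in> carrier (Sub C M (Fo X))"
    and sub_map_mem: "k \<in> K \<Longrightarrow> Fa k \<in> sub_map C M Fa K"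
proof -
  obtain m where m: "m \<in> M'" "m \<in> Hom A (Dom A m) X" "m \<in> K"
    using assms by (rule A.carrierE)
  have M: "Fa k \<in> M" "Fa k \<in> Arr C" if "k \<in> K" for k
    using preserves A.carrier_mem[OF assms that] C.M_arr unfolding preserves_subobjects_def by auto
  have eq_m: "sub_class C M (Fa k) = sub_class C M (Fa m)" if "k \<in> K" for k
  proof -
    note k = A.carrier_mem(2)[OF assms that] and m' = A.carrier_mem(2)[OF assms m(3)]
    have "factors_through A k K" "factors_through A m K"
      using that m(3) A.arr_le_refl k m' unfolding factors_through_def by blast+
    then have "arr_le A k m" "arr_le A m k"
      using A.factors_iff[OF assms] that m(3) by blast+
    then show ?thesis
      using F_arr_le k m' M that m(3) by (intro C.sub_class_eq) auto
  qed
  have eq: "sub_map C M Fa K = sub_class C M (Fa m)"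
  proof -
    have "{sub_class C M (Fa k) | k. k \<in> K} = {sub_class C M (Fa m)}"
      using eq_m m(3) by blast
    then show ?thesis unfolding sub_map_def by simp
  qed
  show "sub_map C M Fa K \<in> carrier (Sub C M (Fo X))"
    unfolding eq using C.sub_class_carrier M(1)[OF m(3)] HomD(3)[OF F_Hom[OF m(2)]] by blast
  show "Fa k \<in> sub_map C M Fa K" if "k \<in> K"
    using that C.sub_class_self M unfolding sub_map_def by blast
qed

lemma sub_map_mono:
  assumes "K \<in> carrier (Sub A M' X)" "L \<in> carrier (Sub A M' X)" "K \<sqsubseteq>\<^bsub>Sub A M' X\<^esub> L"
  shows "sub_map C M Fa K \<sqsubseteq>\<^bsub>Sub C M (Fo X)\<^esub> sub_map C M Fa L"
proof -
  obtain k l where k: "k \<in> K" and l: "l \<in> L" using assms A.carrierE by metis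
  have "arr_le C (Fa k) (Fa l)"
    using assms k l F_arr_le A.carrier_mem A.le_iff_factors A.factors_iff by metis
  then show ?thesis
    using sub_map_mem[OF assms(1) k] sub_map_mem[OF assms(2) l] unfolding le_Sub by blast
qed

text \<open>The functor carries the factorization of \<open>f \<odot> k\<close> through its image to
  one of \<open>Fa f \<odot> Fa k\<close> through \<open>sub_map\<close> of that image. The image
  formed in \<open>C\<close> is the least subobject with this property.\<close>

lemma sub_image_sub_map_le:
  assumes "f \<in> Hom A X Y" "K \<in> carrier (Sub A M' X)"
  shows "sub_image C E M (Fa f) (sub_map C M Fa K) \<sqsubseteq>\<^bsub>Sub C M (Fo Y)\<^esub>
         sub_map C M Fa (sub_image A E' M' f K)"
proof -
  let ?I = "sub_image A E' M' f K"
  obtain k where k: "k \<in> K" using assms(2) by (rule A.carrierE)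
  have I: "?I \<in> carrier (Sub A M' Y)" using A.sub_image_carrier assms by blast
  obtain i where i: "i \<in> ?I" using I by (rule A.carrierE)
  note kh = A.carrier_mem(4)[OF assms(2) k]
  have "arr_le A (f \<odot>\<^bsub>A\<^esub> k) i"
    using A.factors_sub_image[OF assms k] A.factors_iff[OF I i] by blast
  then have "arr_le C (Fa f \<odot>\<^bsub>C\<^esub> Fa k) (Fa i)"
    using F_arr_le F_comp[OF kh assms(1)] HomD(1)[OF A.comp_hom[OF kh assms(1)]]
      A.carrier_mem(2)[OF I i] by metis
  then have "factors_through C (Fa f \<odot>\<^bsub>C\<^esub> Fa k) (sub_map C M Fa ?I)"
    using sub_map_mem[OF I i] unfolding factors_through_def by blast
  then show ?thesis
    using C.sub_image_le[OF F_Hom[OF assms(1)] sub_map_carrier[OF assms(2)]]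
      sub_map_mem[OF assms(2) k] sub_map_carrier[OF I] by blast
qed

end

section \<open>The Galois connection on subobjects induced by the adjunction\<close>

locale subobject_adjunction =
  A: subobject_lattices A E' M' + C: subobject_lattices C E M
  for A :: "('p, 'b) cat_data" and E' M' :: "'b set"
    and C :: "('o, 'a) cat_data" and E M :: "'a set" +
  fixes Fo :: "'p \<Rightarrow> 'o" and Fa :: "'b \<Rightarrow> 'a" and Go :: "'o \<Rightarrow> 'p" and Ga :: "'a \<Rightarrow> 'b"
    and \<eta> :: "'p \<Rightarrow> 'b"
  assumes adj: "is_adjunction A C Fo Fa Go Ga \<eta>"
    and G_sub: "preserves_subobjects M M' Ga"
    and F_sub: "preserves_subobjects M' M Fa"

sublocale subobject_adjunction \<subseteq> F: subobject_functor A E' M' C E M Fo Fa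
  using adj F_sub by unfold_locales (simp_all add: is_adjunction_def)

text \<open>The same facts for the right adjoint, with the roles of the two categories
  exchanged.\<close>

sublocale subobject_adjunction \<subseteq> G: subobject_functor C E M A E' M' Go Ga
  using adj G_sub by unfold_locales (simp_all add: is_adjunction_def)

context subobject_adjunction
begin

abbreviation F_map where "F_map \<equiv> sub_map C M Fa"

abbreviation F_radj where "F_radj X L \<equiv> sub_preimage A M' (\<eta> X) (sub_map A M' Ga L)"

abbreviation conj_map where "conj_map \<equiv> unit_map A M' C M Fa Ga \<eta>"

lemma unit_Hom: "X \<in> Obj A \<Longrightarrow> \<eta> X \<in> Hom A X (Go (Fo X))"
  and unit_natural: "f \<in> Hom A X Y \<Longrightarrow> Ga (Fa f) \<odot>\<^bsub>A\<^esub> \<eta> X = \<eta> Y \<odot>\<^bsub>A\<^esub> f"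
  using adj unfolding is_adjunction_def by blast+

lemma unit_universal: "\<lbrakk>X \<in> Obj A; Y \<in> Obj C; f \<in> Hom A X (Go Y)\<rbrakk> \<Longrightarrow>
        \<exists>!g. g \<in> Hom C (Fo X) Y \<and> Ga g \<odot>\<^bsub>A\<^esub> \<eta> X = f"
  using adj unfolding is_adjunction_def by blast

text \<open>A factorization \<open>t\<close> of \<open>\<eta> X \<odot> h\<close> through
  \<open>Ga u\<close> transposes to a factorization \<open>s\<close> of \<open>Fa h\<close> through
  \<open>u\<close>. Conversely, \<open>Ga\<close> applied to a factorization of \<open>Fa h\<close>
  and composed with the unit gives one of \<open>\<eta> X \<odot> h\<close>, by naturality.\<close>

lemma transpose_arr_le:
  assumes h: "h \<in> Hom A Z X" and u: "u \<in> Hom C W (Fo X)"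
  shows "arr_le A (\<eta> X \<odot>\<^bsub>A\<^esub> h) (Ga u) \<longleftrightarrow> arr_le C (Fa h) u"
proof
  have Z: "Z \<in> Obj A" and X: "X \<in> Obj A" and W: "W \<in> Obj C"
    using h u A.dom_obj A.cod_obj C.dom_obj by (auto simp: Hom_def)
  note Fh = F.F_Hom[OF h] and Gu = G.F_Hom[OF u] and uZ = unit_Hom[OF Z]
  note GFh = G.F_Hom[OF Fh] and hX = A.comp_hom[OF h unit_Hom[OF X]]
  { assume "arr_le A (\<eta> X \<odot>\<^bsub>A\<^esub> h) (Ga u)"
    then obtain t where t: "t \<in> Hom A Z (Go W)" "Ga u \<odot>\<^bsub>A\<^esub> t = \<eta> X \<odot>\<^bsub>A\<^esub> h"
      unfolding arr_le_def using HomD(2)[OF hX] HomD(2)[OF Gu] by auto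
    obtain s where s: "s \<in> Hom C (Fo Z) W" "Ga s \<odot>\<^bsub>A\<^esub> \<eta> Z = t"
      using unit_universal[OF Z W t(1)] by blast
    have us: "u \<odot>\<^bsub>C\<^esub> s \<in> Hom C (Fo Z) (Fo X)" using C.comp_hom s(1) u by blast
    have "Ga (u \<odot>\<^bsub>C\<^esub> s) \<odot>\<^bsub>A\<^esub> \<eta> Z = Ga u \<odot>\<^bsub>A\<^esub> (Ga s \<odot>\<^bsub>A\<^esub> \<eta> Z)"
      using G.F_comp[OF s(1) u] A.comp_assoc[OF uZ G.F_Hom[OF s(1)] Gu] by simp
    also have "\<dots> = Ga (Fa h) \<odot>\<^bsub>A\<^esub> \<eta> Z" using s t unit_natural[OF h] by simp
    \<comment> \<open>Both arrows have the same transpose along \<open>\<eta> Z\<close>, so the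
      uniqueness clause of the universal property identifies them.\<close>
    finally have "u \<odot>\<^bsub>C\<^esub> s = Fa h"
      using unit_universal[OF Z F.F_Obj[OF X] A.comp_hom[OF uZ GFh]] us Fh by blast
    then show "arr_le C (Fa h) u" using C.arr_le_comp[OF s(1) u] by simp }
  assume "arr_le C (Fa h) u"
  then have "arr_le A (Ga (Fa h)) (Ga u)"
    using G.F_arr_le Fh u HomD(1) by metis
  moreover have "arr_le A (\<eta> X \<odot>\<^bsub>A\<^esub> h) (Ga (Fa h))"
    using A.arr_le_comp[OF uZ GFh] unit_natural[OF h] by simp
  ultimately show "arr_le A (\<eta> X \<odot>\<^bsub>A\<^esub> h) (Ga u)" using A.arr_le_trans HomD(1)[OF Gu] by blast
qed

lemma F_radj_carrier:
  assumes "X \<in> Obj A" "L \<in> carrier (Sub C M (Fo X))"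
  shows "F_radj X L \<in> carrier (Sub A M' X)"
  using A.sub_preimage_carrier[OF unit_Hom] G.sub_map_carrier assms by blast

text \<open>The pullback replaces \<open>h\<close> by \<open>\<eta> X \<odot> h\<close>, and
  \<open>transpose_arr_le\<close> then crosses the adjunction. An arbitrary \<open>h\<close> is
  allowed because (U5) needs the case of a composite \<open>f \<odot> n\<close>.\<close>

lemma factors_F_radj:
  assumes "L \<in> carrier (Sub C M (Fo X))" "h \<in> Hom A Z X"
  shows "factors_through A h (F_radj X L) \<longleftrightarrow> factors_through C (Fa h) L"
proof -
  have X: "X \<in> Obj A" using assms(2) A.cod_obj by (auto simp: Hom_def)
  obtain l where l: "l \<in> L" using assms(1) by (rule C.carrierE)
  note G = G.sub_map_carrier[OF assms(1)] G.sub_map_mem[OF assms(1) l]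
  show ?thesis
    using A.factors_sub_preimage[OF unit_Hom[OF X] G(1) assms(2)] A.factors_iff[OF G]
      transpose_arr_le[OF assms(2) C.carrier_mem(4)[OF assms(1) l]] C.factors_iff[OF assms(1) l]
    by simp
qed

text \<open>The case of \<open>factors_F_radj\<close> in which \<open>h\<close> represents
  \<open>K\<close>: \<open>F_map\<close> is left adjoint to \<open>F_radj X\<close>.\<close>

lemma sub_map_le_iff:
  assumes "X \<in> Obj A" "K \<in> carrier (Sub A M' X)" "L \<in> carrier (Sub C M (Fo X))"
  shows "F_map K \<sqsubseteq>\<^bsub>Sub C M (Fo X)\<^esub> L \<longleftrightarrow> K \<sqsubseteq>\<^bsub>Sub A M' X\<^esub> F_radj X L"
proof -
  obtain k where k: "k \<in> K" using assms(2) by (rule A.carrierE)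
  show ?thesis
    using C.le_iff_factors[OF F.sub_map_carrier[OF assms(2)] assms(3) F.sub_map_mem[OF assms(2) k]]
      A.le_iff_factors[OF assms(2) F_radj_carrier[OF assms(1,3)] k]
      factors_F_radj[OF assms(3) A.carrier_mem(4)[OF assms(2) k]] by simp
qed

section \<open>Conjugating a self-map by the Galois connection\<close>

lemma conj_map_carrier:
  assumes "X \<in> Obj A" "U \<in> monotone_maps (Sub C M (Fo X))" "K \<in> carrier (Sub A M' X)"
  shows "conj_map X U K \<in> carrier (Sub A M' X)"
  using assms F_radj_carrier C.monotone_maps_carrier F.sub_map_carrier
  unfolding unit_map_def by simp

text \<open>On the carrier, \<open>conj_map X U\<close> is \<open>F_radj X\<close> after
  \<open>U\<close> after \<open>F_map\<close>, so this is the Galois connection at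
  \<open>U (F_map K)\<close>.\<close>

lemma le_conj_map:
  assumes "X \<in> Obj A" "U \<in> monotone_maps (Sub C M (Fo X))"
    and "K \<in> carrier (Sub A M' X)" "N \<in> carrier (Sub A M' X)"
  shows "N \<sqsubseteq>\<^bsub>Sub A M' X\<^esub> conj_map X U K \<longleftrightarrow> F_map N \<sqsubseteq>\<^bsub>Sub C M (Fo X)\<^esub> U (F_map K)"
  using assms sub_map_le_iff C.monotone_maps_carrier F.sub_map_carrier
  unfolding unit_map_def by simp

text \<open>The counit inequality of the Galois connection at \<open>U (F_map K)\<close>: test
  \<open>le_conj_map\<close> on its own right-hand side.\<close>

lemma sub_map_conj_map_le:
  assumes "X \<in> Obj A" "U \<in> monotone_maps (Sub C M (Fo X))" "K \<in> carrier (Sub A M' X)"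
  shows "F_map (conj_map X U K) \<sqsubseteq>\<^bsub>Sub C M (Fo X)\<^esub> U (F_map K)"
  using le_conj_map[OF assms conj_map_carrier[OF assms]] A.Sub_refl[OF conj_map_carrier[OF assms]]
  by blast

lemma conj_map_monotone:
  assumes X: "X \<in> Obj A" and U: "U \<in> monotone_maps (Sub C M (Fo X))"
  shows "conj_map X U \<in> monotone_maps (Sub A M' X)"
  unfolding A.monotone_maps_Sub
proof (intro conjI ballI impI)
  show "conj_map X U \<in> carrier (Sub A M' X) \<rightarrow>\<^sub>E carrier (Sub A M' X)"
    using conj_map_carrier[OF assms] by (auto simp: unit_map_def)
next
  fix K L assume K: "K \<in> carrier (Sub A M' X)" and L: "L \<in> carrier (Sub A M' X)"
    and "K \<sqsubseteq>\<^bsub>Sub A M' X\<^esub> L"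
  then have "F_map K \<sqsubseteq>\<^bsub>Sub C M (Fo X)\<^esub> F_map L" using F.sub_map_mono by blast
  then have "U (F_map K) \<sqsubseteq>\<^bsub>Sub C M (Fo X)\<^esub> U (F_map L)"
    using C.monotone_maps_mono[OF U] F.sub_map_carrier K L by blast
  then have "F_map (conj_map X U K) \<sqsubseteq>\<^bsub>Sub C M (Fo X)\<^esub> U (F_map L)"
    using sub_map_conj_map_le[OF X U K] C.monotone_maps_carrier[OF U F.sub_map_carrier]
      F.sub_map_carrier[OF conj_map_carrier[OF X U K]] C.Sub_trans K L by metis
  then show "conj_map X U K \<sqsubseteq>\<^bsub>Sub A M' X\<^esub> conj_map X U L"
    using le_conj_map[OF X U L conj_map_carrier[OF X U K]] by blast
qed

text \<open>Right adjoints preserve meets: at each \<open>K\<close> both sides have the same lower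
  bounds. Equality of maps is what makes the conjugates closed under meets in (U4).\<close>

lemma conj_map_meet:
  assumes X: "X \<in> Obj A" and U: "U \<in> monotone_maps (Sub C M (Fo X))"
    and V: "V \<in> monotone_maps (Sub C M (Fo X))"
  shows "map_meet (Sub A M' X) (conj_map X U) (conj_map X V) =
         conj_map X (map_meet (Sub C M (Fo X)) U V)" (is "?l = ?r")
proof -
  note FX = F.F_Obj[OF X]
  note UV = C.map_meet_monotone[OF FX U V]
  note lm = A.map_meet_monotone[OF X conj_map_monotone[OF X U] conj_map_monotone[OF X V]]
    and rm = conj_map_monotone[OF X UV]
  have iff: "N \<sqsubseteq>\<^bsub>Sub A M' X\<^esub> ?l K \<longleftrightarrow> N \<sqsubseteq>\<^bsub>Sub A M' X\<^esub> ?r K"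
    if K: "K \<in> carrier (Sub A M' X)" and N: "N \<in> carrier (Sub A M' X)" for K N
    unfolding A.le_map_meet[OF X conj_map_monotone[OF X U] conj_map_monotone[OF X V] K N]
      le_conj_map[OF X U K N] le_conj_map[OF X V K N] le_conj_map[OF X UV K N]
      C.le_map_meet[OF FX U V F.sub_map_carrier[OF K] F.sub_map_carrier[OF N]] ..
  have "?l K = ?r K" if K: "K \<in> carrier (Sub A M' X)" for K
    using A.Sub_antisym[of "?l K" X "?r K"] iff[OF K] A.Sub_refl
      A.monotone_maps_carrier[OF lm K] A.monotone_maps_carrier[OF rm K] by blast
  \<comment> \<open>Both maps are \<open>undefined\<close> off the carrier, so agreement on the
    carrier makes them equal as functions.\<close>
  moreover have "?l \<in> extensional (carrier (Sub A M' X))" "?r \<in> extensional (carrier (Sub A M' X))"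
    by (simp_all add: map_meet_def unit_map_def)
  ultimately show ?thesis by (metis extensionalityI)
qed

section \<open>The base axioms for the conjugated family\<close>

lemma quasi_uniformity_base_unit_base:
  assumes "quasi_uniformity_base C E M \<B>"
  shows "quasi_uniformity_base A E' M' (unit_base A M' C M Fo Fa Ga \<eta> \<B>)"
proof -
  interpret B: quasi_uniformity_base C E M \<B> by fact
  have mono: "U \<in> monotone_maps (Sub C M (Fo X))" if "X \<in> Obj A" "U \<in> \<B> (Fo X)" for X U
    using that B.monotone F.F_Obj by blast
  show ?thesis
    unfolding unit_base_def
  proof
    fix X assume X: "X \<in> Obj A"
    note FX = F.F_Obj[OF X] and m = mono[OF X]
    show "conj_map X ` \<B> (Fo X) \<subseteq> monotone_maps (Sub A M' X)"
      using conj_map_monotone X m by blast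
    fix W assume "W \<in> conj_map X ` \<B> (Fo X)"
    then obtain U where U: "U \<in> \<B> (Fo X)" and W: "W = conj_map X U" by blast
    \<comment> \<open>Transposed, this is (U1) for \<open>U\<close> at
      \<open>F_map K\<close>.\<close>
    show "K \<sqsubseteq>\<^bsub>Sub A M' X\<^esub> W K" if K: "K \<in> carrier (Sub A M' X)" for K
      unfolding W using B.U1[OF FX U] F.sub_map_carrier K le_conj_map X m[OF U] by blast
    obtain U' where U': "U' \<in> \<B> (Fo X)" "map_le (Sub C M (Fo X)) (U' \<circ> U') U"
      using B.U2 FX U by blast
    \<comment> \<open>Between the two copies of \<open>U'\<close> stands \<open>F_map\<close> after
      \<open>F_radj X\<close>, which lies below the identity. The square of the conjugate of
      \<open>U'\<close> is therefore below the conjugate of \<open>U' \<circ> U'\<close>, hence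
      below that of \<open>U\<close>.\<close>
    have "map_le (Sub A M' X) (conj_map X U' \<circ> conj_map X U') W"
      unfolding map_le_def comp_apply
    proof
      fix K assume K: "K \<in> carrier (Sub A M' X)"
      define L where "L = conj_map X U' K"
      note c = conj_map_carrier[OF X m[OF U'(1)]]
      have L: "L \<in> carrier (Sub A M' X)" unfolding L_def using c K .
      note FK = F.sub_map_carrier[OF K] and FL = F.sub_map_carrier[OF L]
      note car = C.monotone_maps_carrier[OF m[OF U'(1)]]
      have "F_map (conj_map X U' L) \<sqsubseteq>\<^bsub>Sub C M (Fo X)\<^esub> U' (F_map L)"
        using sub_map_conj_map_le X m[OF U'(1)] L by blast
      moreover have "U' (F_map L) \<sqsubseteq>\<^bsub>Sub C M (Fo X)\<^esub> U' (U' (F_map K))"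
        unfolding L_def using sub_map_conj_map_le[OF X m[OF U'(1)] K]
          C.monotone_maps_mono[OF m[OF U'(1)]] FL[unfolded L_def] car[OF FK] by blast
      moreover have "U' (U' (F_map K)) \<sqsubseteq>\<^bsub>Sub C M (Fo X)\<^esub> U (F_map K)"
        using U'(2) FK unfolding map_le_def by simp
      ultimately have "F_map (conj_map X U' L) \<sqsubseteq>\<^bsub>Sub C M (Fo X)\<^esub> U (F_map K)"
        using C.Sub_trans F.sub_map_carrier[OF c[OF L]] car FK FL
          C.monotone_maps_carrier[OF m[OF U] FK] by metis
      then show "conj_map X U' (conj_map X U' K) \<sqsubseteq>\<^bsub>Sub A M' X\<^esub> W K"
        unfolding W using le_conj_map[OF X m[OF U] K c[OF L]] unfolding L_def by blast
    qed
    then show "\<exists>W' \<in> conj_map X ` \<B> (Fo X). map_le (Sub A M' X) (W' \<circ> W') W"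
      using U'(1) by blast
    fix W' assume "W' \<in> conj_map X ` \<B> (Fo X)"
    then obtain V where V: "V \<in> \<B> (Fo X)" and W': "W' = conj_map X V" by blast
    show "map_meet (Sub A M' X) W W' \<in> conj_map X ` \<B> (Fo X)"
      unfolding W W' conj_map_meet[OF X m[OF U] m[OF V]] using B.U4[OF FX U V] by blast
  next
    fix f X Y W assume f: "f \<in> Hom A X Y" and "W \<in> conj_map Y ` \<B> (Fo Y)"
    then obtain U where U: "U \<in> \<B> (Fo Y)" and W: "W = conj_map Y U" by blast
    have X: "X \<in> Obj A" and Y: "Y \<in> Obj A" using f A.dom_obj A.cod_obj by (auto simp: Hom_def)
    note Ff = F.F_Hom[OF f] and Um = mono[OF Y U]
    \<comment> \<open>The witness for (U5) in \<open>A\<close> will be the conjugate of the map that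
      (U5) in \<open>C\<close> supplies for \<open>Fa f\<close>.\<close>
    obtain U' where U': "U' \<in> \<B> (Fo X)" and le: "\<And>K. K \<in> carrier (Sub C M (Fo X)) \<Longrightarrow>
        sub_image C E M (Fa f) (U' K) \<sqsubseteq>\<^bsub>Sub C M (Fo Y)\<^esub> U (sub_image C E M (Fa f) K)"
      using B.U5 Ff U by blast
    note U'm = mono[OF X U']
    have "sub_image A E' M' f (conj_map X U' K) \<sqsubseteq>\<^bsub>Sub A M' Y\<^esub> W (sub_image A E' M' f K)"
      if K: "K \<in> carrier (Sub A M' X)" for K
    proof -
      let ?N = "conj_map X U' K" and ?I = "sub_image A E' M' f K"
      let ?J = "sub_image C E M (Fa f) (U' (F_map K))"
      have N: "?N \<in> carrier (Sub A M' X)" and I: "?I \<in> carrier (Sub A M' Y)"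
        using conj_map_carrier[OF X U'm K] A.sub_image_carrier[OF f K] .
      obtain n where n: "n \<in> ?N" using N by (rule A.carrierE)
      note nh = A.carrier_mem(4)[OF N n]
      note FK = F.sub_map_carrier[OF K] and FI = F.sub_map_carrier[OF I]
      note U'FK = C.monotone_maps_carrier[OF U'm FK]
      obtain u where u: "u \<in> U' (F_map K)" using U'FK by (rule C.carrierE)
      note uh = C.carrier_mem(4)[OF U'FK u]
      note J = C.sub_image_carrier[OF Ff U'FK] and UFI = C.monotone_maps_carrier[OF Um FI]
      note FFK = C.sub_image_carrier[OF Ff FK]
      \<comment> \<open>The counit inequality, read on the representatives \<open>n\<close> and
        \<open>u\<close>.\<close>
      have "arr_le C (Fa n) u"
        using sub_map_conj_map_le[OF X U'm K] C.factors_iff[OF U'FK u]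
          C.le_iff_factors[OF F.sub_map_carrier[OF N] U'FK F.sub_map_mem[OF N n]] by blast
      then have "arr_le C (Fa (f \<odot>\<^bsub>A\<^esub> n)) (Fa f \<odot>\<^bsub>C\<^esub> u)"
        using C.arr_le_comp_left uh Ff F.F_comp[OF nh f] by metis
      then have "factors_through C (Fa (f \<odot>\<^bsub>A\<^esub> n)) ?J"
        using C.factors_sub_image[OF Ff U'FK u] C.factors_comp[OF J] by blast
      moreover have "?J \<sqsubseteq>\<^bsub>Sub C M (Fo Y)\<^esub> U (sub_image C E M (Fa f) (F_map K))"
        using le FK by blast
      \<comment> \<open>Monotonicity of \<open>U\<close> replaces the image taken in
        \<open>C\<close> by the \<open>F_map\<close> of the image taken in \<open>A\<close>; the
        one-sided comparison \<open>sub_image_sub_map_le\<close> goes the right way.\<close>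
      moreover have "U (sub_image C E M (Fa f) (F_map K)) \<sqsubseteq>\<^bsub>Sub C M (Fo Y)\<^esub> U (F_map ?I)"
        using C.monotone_maps_mono[OF Um FFK FI] F.sub_image_sub_map_le[OF f K] by blast
      ultimately have "factors_through C (Fa (f \<odot>\<^bsub>A\<^esub> n)) (U (F_map ?I))"
        using C.factors_le J UFI C.monotone_maps_carrier[OF Um FFK] by metis
      \<comment> \<open>Transposed back to \<open>A\<close>, the factorization concerns
        \<open>f \<odot> n\<close> itself, and minimality of the image of \<open>?N\<close> finishes
        the argument.\<close>
      then have "factors_through A (f \<odot>\<^bsub>A\<^esub> n) (conj_map Y U ?I)"
        using factors_F_radj[OF UFI A.comp_hom[OF nh f]] I unfolding unit_map_def by simp
      then show ?thesis
        unfolding W using A.sub_image_le[OF f N n] conj_map_carrier[OF Y Um I] by blast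
    qed
    then show "\<exists>W' \<in> conj_map X ` \<B> (Fo X). \<forall>K \<in> carrier (Sub A M' X).
        sub_image A E' M' f (W' K) \<sqsubseteq>\<^bsub>Sub A M' Y\<^esub> W (sub_image A E' M' f K)"
      using U' by blast
  qed
qed

section \<open>Continuity of \<open>F\<close> and minimality of the induced quasi-uniformity\<close>

lemma qu_continuous_unit_base:
  assumes "quasi_uniformity_base C E M \<B>"
  shows "qu_continuous A M' C M Fo Fa
           (generated_qu A M' (unit_base A M' C M Fo Fa Ga \<eta> \<B>)) (generated_qu C M \<B>)"
  unfolding qu_continuous_def
proof (intro ballI)
  interpret B: quasi_uniformity_base C E M \<B> by fact
  fix X U assume X: "X \<in> Obj A" and "U \<in> generated_qu C M \<B> (Fo X)"
  then obtain V where V: "V \<in> \<B> (Fo X)" "map_le (Sub C M (Fo X)) V U"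
    and Um: "U \<in> monotone_maps (Sub C M (Fo X))"
    unfolding generated_qu_def by blast
  have Vm: "V \<in> monotone_maps (Sub C M (Fo X))" using B.monotone F.F_Obj X V by blast
  \<comment> \<open>The witness is the conjugate of a base member below \<open>U\<close>; continuity
    is then the counit inequality followed by \<open>V \<le> U\<close>.\<close>
  have "conj_map X V \<in> generated_qu A M' (unit_base A M' C M Fo Fa Ga \<eta> \<B>) X"
    using V(1) conj_map_monotone[OF X Vm] A.Sub_refl conj_map_carrier[OF X Vm]
    unfolding generated_qu_def map_le_def unit_base_def by blast
  moreover have "F_map (conj_map X V K) \<sqsubseteq>\<^bsub>Sub C M (Fo X)\<^esub> U (F_map K)"
    if K: "K \<in> carrier (Sub A M' X)" for K
    using sub_map_conj_map_le[OF X Vm K] V(2) F.sub_map_carrier[OF K]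
      F.sub_map_carrier[OF conj_map_carrier[OF X Vm K]]
      C.monotone_maps_carrier[OF Um] C.monotone_maps_carrier[OF Vm] C.Sub_trans
    unfolding map_le_def by blast
  ultimately show "\<exists>W \<in> generated_qu A M' (unit_base A M' C M Fo Fa Ga \<eta> \<B>) X.
      \<forall>K \<in> carrier (Sub A M' X). F_map (W K) \<sqsubseteq>\<^bsub>Sub C M (Fo X)\<^esub> U (F_map K)"
    by blast
qed

text \<open>Transposed by \<open>le_conj_map\<close>, the continuity inequality for a base member
  \<open>V\<close> says exactly that some \<open>W\<close> in \<open>\<W> X\<close> lies below the
  conjugate of \<open>V\<close>, hence below every map above that conjugate.\<close>

lemma unit_base_coarsest:
  assumes "quasi_uniformity_base C E M \<B>" and "quasi_uniformity A E' M' \<W>"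
    and cont: "qu_continuous A M' C M Fo Fa \<W> (generated_qu C M \<B>)"
  shows "qu_le A M' (generated_qu A M' (unit_base A M' C M Fo Fa Ga \<eta> \<B>)) \<W>"
  unfolding qu_le_def
proof (intro ballI)
  interpret B: quasi_uniformity_base C E M \<B> by fact
  interpret W: quasi_uniformity A E' M' \<W> by fact
  fix X U assume X: "X \<in> Obj A" and "U \<in> generated_qu A M' (unit_base A M' C M Fo Fa Ga \<eta> \<B>) X"
  then obtain V where V: "V \<in> \<B> (Fo X)" "map_le (Sub A M' X) (conj_map X V) U"
    and Um: "U \<in> monotone_maps (Sub A M' X)"
    unfolding generated_qu_def unit_base_def by blast
  have Vm: "V \<in> monotone_maps (Sub C M (Fo X))" using B.monotone F.F_Obj X V by blast
  \<comment> \<open>Continuity is assumed for the generated family, so \<open>V\<close> is first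
    placed there by reflexivity.\<close>
  have "V \<in> generated_qu C M \<B> (Fo X)"
    using V(1) Vm C.Sub_refl C.monotone_maps_carrier[OF Vm]
    unfolding generated_qu_def map_le_def by blast
  then obtain W where W: "W \<in> \<W> X" and le: "\<And>K. K \<in> carrier (Sub A M' X) \<Longrightarrow>
      F_map (W K) \<sqsubseteq>\<^bsub>Sub C M (Fo X)\<^esub> V (F_map K)"
    using cont X unfolding qu_continuous_def by blast
  have Wm: "W \<in> monotone_maps (Sub A M' X)" using W.monotone X W by blast
  have "W K \<sqsubseteq>\<^bsub>Sub A M' X\<^esub> U K" if K: "K \<in> carrier (Sub A M' X)" for K
  proof -
    note c = A.monotone_maps_carrier[OF Wm K]
    have "W K \<sqsubseteq>\<^bsub>Sub A M' X\<^esub> conj_map X V K" using le_conj_map[OF X Vm K c] le[OF K] by blast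
    then show ?thesis
      using V(2) K c A.monotone_maps_carrier[OF Um K] conj_map_carrier[OF X Vm K] A.Sub_trans
      unfolding map_le_def by blast
  qed
  then show "\<exists>W \<in> \<W> X. map_le (Sub A M' X) W U" using W unfolding map_le_def by blast
qed

end

section \<open>The quasi-uniformity induced along the unit\<close>

theorem theorem5:
  fixes C :: "('o, 'a) cat_data" and E M :: "'a set"
    and A :: "('p, 'b) cat_data" and E' M' :: "'b set"
    and Fo :: "'p \<Rightarrow> 'o" and Fa :: "'b \<Rightarrow> 'a"
    and Go :: "'o \<Rightarrow> 'p" and Ga :: "'a \<Rightarrow> 'b"
    and \<eta> :: "'p \<Rightarrow> 'b"
    and \<B> \<U> :: "('o, 'a) map_family"
    and \<B>\<^sub>\<eta> \<U>\<^sub>\<eta> :: "('p, 'b) map_family"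
  assumes "proper_factorization_system C E M" and "M_complete C M"
    and "factorization_system A E' M'" and "M_complete A M'"
    and "is_adjunction A C Fo Fa Go Ga \<eta>"
    and "preserves_subobjects M M' Ga" and "preserves_subobjects M' M Fa"
    and "quasi_uniformity_base C E M \<B>" and "\<U> = generated_qu C M \<B>"
    and "\<B>\<^sub>\<eta> = unit_base A M' C M Fo Fa Ga \<eta> \<B>" and "\<U>\<^sub>\<eta> = generated_qu A M' \<B>\<^sub>\<eta>"
  shows "quasi_uniformity_base A E' M' \<B>\<^sub>\<eta> \<and>
         quasi_uniformity A E' M' \<U>\<^sub>\<eta> \<and>
         qu_continuous A M' C M Fo Fa \<U>\<^sub>\<eta> \<U> \<and>
         (\<forall>\<W>. quasi_uniformity A E' M' \<W> \<and> qu_continuous A M' C M Fo Fa \<W> \<U> \<longrightarrow>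
               qu_le A M' \<U>\<^sub>\<eta> \<W>)"


proof -
  interpret subobject_adjunction A E' M' C E M Fo Fa Go Ga \<eta>
    using assms(1-7)
    by (simp add: subobject_adjunction_def subobject_adjunction_axioms_def subobject_lattices_def
        proper_factorization_system_def)
  show ?thesis
    \<comment> \<open>The second conjunct follows from the first, since every base in
      \<open>A\<close> generates a quasi-uniformity.\<close>
    unfolding assms(9-11)
    using quasi_uniformity_base_unit_base[OF assms(8)] qu_continuous_unit_base[OF assms(8)]
      unit_base_coarsest[OF assms(8)] A.quasi_uniformity_generated by blast
qed

end
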